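(* Let $W=\{w_1,\dots,w_{23}\}$ be the contact configuration obtained by deleting one vector from the set of $24$ normalised roots of $D_4$. Every first-order motion of $W$ through contact configurations is an infinitesimal rotation.
   Context: The normalised roots of $D_4$ are the $24$ unit vectors $(\pm e_i\pm e_j)/\sqrt2$, $1\le i<j\le4$, in $\mathbb{R}^4$; distinct ones have inner product at most $\frac12$. A contact configuration is a finite set of unit vectors in $\mathbb{R}^4$ with pairwise inner products at most $\frac12$. A first-order motion of $W$ through contact configurations is a tuple $d=(d_1,\dots,d_{23})$ of vectors $d_i\in\mathbb{R}^4$ with $\langle d_i,w_i\rangle=0$ for every $i$ and $\langle d_i,w_j\rangle+\langle w_i,d_j\rangle\le0$ for every pair $i\neq j$ with $\langle w_i,w_j\rangle=\frac12$. It is an infinitesimal rotation if there is an antisymmetric $4\times4$ real matrix $A$ with $d_i=Aw_i$ for all $i$. *)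

theory Defs
  imports "HOL-Analysis.Analysis"
begin

text \<open>The coordinates are indexed by the numeral type \<open>4\<close>, ordered as \<open>0 < 1 < 2 < 3\<close>.\<close>

definition normalised_D4_roots :: "(real ^ 4) set" where
  "normalised_D4_roots =
     {(1 / sqrt 2) *\<^sub>R (s *\<^sub>R axis i 1 + t *\<^sub>R axis j 1) | s t i j.
        s \<in> {1, - 1} \<and> t \<in> {1, - 1} \<and> i < j}"

definition contact_configuration :: "(real ^ 4) set \<Rightarrow> bool" where
  "contact_configuration W \<longleftrightarrow>
     finite W \<and> (\<forall>x\<in>W. norm x = 1) \<and> (\<forall>x\<in>W. \<forall>y\<in>W. x \<noteq> y \<longrightarrow> x \<bullet> y \<le> 1 / 2)"

text \<open>A labelled configuration is a family \<open>w\<close> of points over an index set \<open>I\<close>; the values of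
  \<open>w\<close> and \<open>d\<close> outside \<open>I\<close> are irrelevant.\<close>

definition first_order_motion :: "'i set \<Rightarrow> ('i \<Rightarrow> real ^ 4) \<Rightarrow> ('i \<Rightarrow> real ^ 4) \<Rightarrow> bool" where
  "first_order_motion I w d \<longleftrightarrow>
     (\<forall>i\<in>I. d i \<bullet> w i = 0) \<and>
     (\<forall>i\<in>I. \<forall>j\<in>I. i \<noteq> j \<and> w i \<bullet> w j = 1 / 2 \<longrightarrow> d i \<bullet> w j + w i \<bullet> d j \<le> 0)"

definition infinitesimal_rotation :: "'i set \<Rightarrow> ('i \<Rightarrow> real ^ 4) \<Rightarrow> ('i \<Rightarrow> real ^ 4) \<Rightarrow> bool" where
  "infinitesimal_rotation I w d \<longleftrightarrow>
     (\<exists>A :: real ^ 4 ^ 4. transpose A = - A \<and> (\<forall>i\<in>I. d i = A *v w i))"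

lemma contact_configuration_normalised_D4_roots: "contact_configuration normalised_D4_roots"
proof -
  let ?f = "\<lambda>(s, t, i, j). (1 / sqrt 2) *\<^sub>R (s *\<^sub>R axis i 1 + t *\<^sub>R axis j 1) :: real ^ 4"
  have form: "\<exists>s t i j. x = (1 / sqrt 2) *\<^sub>R (s *\<^sub>R axis i 1 + t *\<^sub>R axis j 1) \<and>
      s \<in> {1, - 1} \<and> t \<in> {1, - 1} \<and> i < j" if "x \<in> normalised_D4_roots" for x
    using that unfolding normalised_D4_roots_def by (rule CollectE)
  have "normalised_D4_roots \<subseteq> ?f ` ({1, - 1} \<times> {1, - 1} \<times> UNIV \<times> UNIV)"
  proof
    fix x :: "real ^ 4"
    assume "x \<in> normalised_D4_roots"
    from form[OF this] obtain s t i j where "x = ?f (s, t, i, j)" "s \<in> {1, - 1}" "t \<in> {1, - 1}"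
      unfolding prod.case by blast
    then show "x \<in> ?f ` ({1, - 1} \<times> {1, - 1} \<times> UNIV \<times> UNIV)"
      by (intro image_eqI[of _ _ "(s, t, i, j)"]) (assumption, blast)
  qed
  then have fin: "finite normalised_D4_roots"
    by (rule finite_subset) simp
  have inner: "2 * (((1 / sqrt 2) *\<^sub>R (s *\<^sub>R axis i 1 + t *\<^sub>R axis j 1)) \<bullet>
      ((1 / sqrt 2) *\<^sub>R (s' *\<^sub>R axis i' 1 + t' *\<^sub>R axis j' 1) :: real ^ 4)) =
      s * s' * (if i = i' then 1 else 0) + s * t' * (if i = j' then 1 else 0) +
      t * s' * (if j = i' then 1 else 0) + t * t' * (if j = j' then 1 else 0)"
    for s t s' t' :: real and i j i' j' :: 4
  proof -
    have "2 * (((1 / sqrt 2) *\<^sub>R a) \<bullet> ((1 / sqrt 2) *\<^sub>R b)) = a \<bullet> b" for a b :: "real ^ 4"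
      by simp
    note half = this
    show ?thesis
      unfolding half
      unfolding inner_add_left inner_add_right inner_scaleR_left inner_scaleR_right inner_axis_axis
      by (simp add: algebra_simps)
  qed
  have unit: "norm x = 1" if x_in: "x \<in> normalised_D4_roots" for x
  proof -
    obtain s t i j where x: "x = (1 / sqrt 2) *\<^sub>R (s *\<^sub>R axis i 1 + t *\<^sub>R axis j 1)"
      and st: "s \<in> {1, - 1}" "t \<in> {1, - 1}" and ij: "i < j"
      using form[OF x_in] by blast
    have "s * s = 1" "t * t = 1" "i \<noteq> j"
      using st ij by auto
    then have "2 * (x \<bullet> x) = 2"
      unfolding x inner by simp
    then show ?thesis
      by (simp add: norm_eq_1)
  qed
  have int: "2 * (x \<bullet> y) \<in> \<int>" if x: "x \<in> normalised_D4_roots" and y: "y \<in> normalised_D4_roots" for x y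
  proof -
    obtain s t i j where x: "x = (1 / sqrt 2) *\<^sub>R (s *\<^sub>R axis i 1 + t *\<^sub>R axis j 1)"
      and st: "s \<in> {1, - 1}" "t \<in> {1, - 1}"
      using form[OF x] by blast
    obtain s' t' i' j' where y: "y = (1 / sqrt 2) *\<^sub>R (s' *\<^sub>R axis i' 1 + t' *\<^sub>R axis j' 1)"
      and st': "s' \<in> {1, - 1}" "t' \<in> {1, - 1}"
      using form[OF y] by blast
    have "s \<in> \<int>" "t \<in> \<int>" "s' \<in> \<int>" "t' \<in> \<int>"
      using st st' by auto
    then show ?thesis
      unfolding x y inner by (intro Ints_add Ints_mult) auto
  qed
  have "x \<bullet> y \<le> 1 / 2"
    if x: "x \<in> normalised_D4_roots" and y: "y \<in> normalised_D4_roots" and "x \<noteq> y" for x y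
  proof -
    have "(x - y) \<bullet> (x - y) > 0"
      using \<open>x \<noteq> y\<close> by simp
    moreover have "x \<bullet> x = 1" "y \<bullet> y = 1"
      using unit[OF x] unit[OF y] by (simp_all add: norm_eq_1)
    ultimately have "2 * (x \<bullet> y) < 2"
      by (simp add: inner_diff_left inner_diff_right inner_commute)
    moreover obtain k where k: "2 * (x \<bullet> y) = of_int k"
      using int[OF x y] by (rule Ints_cases)
    ultimately have "k \<le> 1"
      by simp
    then show ?thesis
      using k by linarith
  qed
  with fin unit show ?thesis
    by (auto simp: contact_configuration_def)
qed

lemma card_normalised_D4_roots: "card normalised_D4_roots = 24"
proof -
  let ?S = "{1, - 1} \<times> {1, - 1} \<times> {(i, j). i < j} :: (real \<times> real \<times> 4 \<times> 4) set"
  let ?f = "\<lambda>(s, t, i, j). (1 / sqrt 2) *\<^sub>R (s *\<^sub>R axis i 1 + t *\<^sub>R axis j 1) :: real ^ 4"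
  have eq: "normalised_D4_roots = ?f ` ?S"
  proof (rule set_eqI, rule iffI)
    fix x
    assume "x \<in> normalised_D4_roots"
    then obtain s t i j where x: "x = ?f (s, t, i, j)"
      and "s \<in> {1, - 1}" "t \<in> {1, - 1}" "i < j"
      unfolding normalised_D4_roots_def mem_Collect_eq prod.case by blast
    then have "(s, t, i, j) \<in> ?S"
      by simp
    with x show "x \<in> ?f ` ?S"
      by (rule image_eqI)
  next
    fix x
    assume "x \<in> ?f ` ?S"
    then obtain p where x: "x = ?f p" and p: "p \<in> ?S"
      by (rule imageE)
    obtain s t i j where eq: "p = (s, t, i, j)"
      by (cases p)
    have "s \<in> {1, - 1}" "t \<in> {1, - 1}" "i < j"
      using p unfolding eq by auto
    then show "x \<in> normalised_D4_roots"
      unfolding x eq prod.case normalised_D4_roots_def mem_Collect_eq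
      by (intro exI conjI) (rule refl | assumption)+
  qed
  have inj: "inj_on ?f ?S"
  proof (rule inj_onI)
    fix p q :: "real \<times> real \<times> 4 \<times> 4"
    assume pq: "p \<in> ?S" "q \<in> ?S" "?f p = ?f q"
    obtain s t i j where p: "p = (s, t, i, j)"
      by (cases p)
    obtain s' t' i' j' where q: "q = (s', t', i', j')"
      by (cases q)
    have st: "s \<in> {1, - 1}" "t \<in> {1, - 1}" "s' \<in> {1, - 1}" "t' \<in> {1, - 1}"
      and ij: "i < j" "i' < j'"
      using pq(1,2) unfolding p q by auto
    have "(1 / sqrt 2) *\<^sub>R (s *\<^sub>R axis i 1 + t *\<^sub>R axis j 1) =
          ((1 / sqrt 2) *\<^sub>R (s' *\<^sub>R axis i' 1 + t' *\<^sub>R axis j' 1) :: real ^ 4)"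
      using pq(3) unfolding p q prod.case .
    then have "s *\<^sub>R axis i 1 + t *\<^sub>R axis j 1 = (s' *\<^sub>R axis i' 1 + t' *\<^sub>R axis j' 1 :: real ^ 4)"
      by simp
    then have "(s *\<^sub>R axis i 1 + t *\<^sub>R axis j 1 :: real ^ 4) $ k =
        (s' *\<^sub>R axis i' 1 + t' *\<^sub>R axis j' 1) $ k" for k
      by (rule arg_cong)
    then have k: "s * (if k = i then 1 else 0) + t * (if k = j then 1 else 0) =
        s' * (if k = i' then 1 else 0) + t' * (if k = j' then 1 else 0)" for k
      unfolding axis_def by simp
    have nz: "s \<noteq> 0" "t \<noteq> 0" "s' \<noteq> 0" "t' \<noteq> 0"
      using st by auto
    have ne: "i \<noteq> j" "i' \<noteq> j'"
      using ij by auto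
    have "i \<in> {i', j'}" "j \<in> {i', j'}"
      using k[of i] k[of j] nz ne by (auto split: if_splits)
    then have "i = i'" "j = j'"
      using ij by auto
    then show "p = q"
      using k[of i] k[of j] ne by (auto simp: p q)
  qed
  have "{(i, j). i < (j :: 4)} = {(0, 1), (0, 2), (0, 3), (1, 2), (1, 3), (2, 3)}"
  proof -
    have cases: "k = 0 \<or> k = 1 \<or> k = 2 \<or> k = (3 :: 4)" for k
      using exhaust_4[of k] by auto
    have "i < j \<longleftrightarrow> (i, j) \<in> {(0, 1), (0, 2), (0, 3), (1, 2), (1, 3), (2, 3)}" for i j :: 4
      using cases[of i] cases[of j]
      by (elim disjE; hypsubst)
        (simp_all add: less_bit0_def bit0.Rep_0 bit0.Rep_1 bit0.Rep_numeral)
    then show ?thesis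
      by (intro set_eqI) (simp only: split_paired_all mem_Collect_eq prod.case)
  qed
  then have "card {(i, j). i < (j :: 4)} = 6"
    by simp
  then have "card ?S = 24"
    by (simp add: card_cartesian_product)
  then show ?thesis
    using inj by (simp add: eq card_image)
qed

end

(* An equilibrium stress that is positive on every edge turns all contact inequalities into
   equalities, so the strain <D x, y> + <x, D y> vanishes for x . y = 1 (roots of squared norm 2).
   The octahedral cells that avoid the deleted root v give zero strain on the orthogonal pairs,
   except on those whose two members both touch v. This already forces D (- y) = - D y, and negating
   one member then reaches every remaining pair. Hence all inner products are preserved to first
   order, and the motion agrees with the skew map determined by its values on an orthogonal frame of
   four roots. *)
theory Submission
  imports Defs
begin

section \<open>Integral model of the D4 root system\<close>

text \<open>Rescaling the unit vectors by \<open>sqrt 2\<close> makes coordinates and inner products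
  integers; the contact value 1/2 becomes 1.\<close>

definition D4_roots :: "(real ^ 4) set" where
  "D4_roots = {x. (\<forall>i. x $ i \<in> \<int>) \<and> x \<bullet> x = 2}"

lemma inner_4: "(x :: real ^ 4) \<bullet> y = x $ 1 * y $ 1 + x $ 2 * y $ 2 + x $ 3 * y $ 3 + x $ 4 * y $ 4"
  by (simp add: inner_vec_def sum_4)

lemma D4_roots_inner_self: "x \<in> D4_roots \<Longrightarrow> x \<bullet> x = 2"
  by (simp add: D4_roots_def)

lemma D4_roots_uminus: "x \<in> D4_roots \<Longrightarrow> - x \<in> D4_roots"
  by (simp add: D4_roots_def)

lemma D4_roots_diff: "x \<in> D4_roots \<Longrightarrow> y \<in> D4_roots \<Longrightarrow> x \<bullet> y = 1 \<Longrightarrow> x - y \<in> D4_roots"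
  by (auto simp: D4_roots_def inner_diff_left inner_diff_right inner_commute)

lemma D4_roots_inner_eq_2:
  assumes "x \<in> D4_roots" "y \<in> D4_roots" "x \<bullet> y = 2"
  shows "x = y"
proof -
  have "(x - y) \<bullet> (x - y) = 0"
    using assms by (simp add: D4_roots_def inner_diff_left inner_diff_right inner_commute)
  then show ?thesis
    by simp
qed

lemma D4_roots_inner_eq_minus_2:
  assumes "x \<in> D4_roots" "y \<in> D4_roots" "x \<bullet> y = - 2"
  shows "x = - y"
  using D4_roots_inner_eq_2[of x "- y"] assms by (simp add: D4_roots_uminus)

text \<open>Integral coordinates make the product an integer, and the squared norms of
  \<open>x - y\<close> and \<open>x + y\<close> being nonnegative bounds it by 2 in absolute
  value.\<close>

lemma D4_roots_inner_cases:
  assumes "x \<in> D4_roots" "y \<in> D4_roots"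
  shows "x \<bullet> y = - 2 \<or> x \<bullet> y = - 1 \<or> x \<bullet> y = 0 \<or> x \<bullet> y = 1 \<or> x \<bullet> y = 2"
proof -
  have "x \<bullet> y \<in> \<int>"
    unfolding inner_4 using assms by (auto simp: D4_roots_def)
  then obtain k where k: "x \<bullet> y = of_int k"
    by (rule Ints_cases)
  have "(x - y) \<bullet> (x - y) \<ge> 0" "(x + y) \<bullet> (x + y) \<ge> 0"
    by (rule inner_ge_zero)+
  then have "\<bar>x \<bullet> y\<bar> \<le> 2"
    using assms by (simp add: D4_roots_def inner_diff_left inner_diff_right inner_add_left
        inner_add_right inner_commute)
  then have "-2 \<le> k" "k \<le> 2"
    unfolding k by linarith+
  then have "k \<in> {-2, -1, 0, 1, 2}"
    by auto
  then show ?thesis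
    unfolding k by auto
qed

section \<open>Orthogonal frames of roots\<close>

text \<open>The half sum is a root having inner product 1 with all four members; it later supplies a
  neighbour of \<open>v\<close> and the vertices of octahedra.\<close>

definition root_frame :: "real ^ 4 \<Rightarrow> real ^ 4 \<Rightarrow> real ^ 4 \<Rightarrow> real ^ 4 \<Rightarrow> bool" where
  "root_frame a b c d \<longleftrightarrow> {a, b, c, d} \<subseteq> D4_roots \<and>
     a \<bullet> b = 0 \<and> a \<bullet> c = 0 \<and> a \<bullet> d = 0 \<and> b \<bullet> c = 0 \<and> b \<bullet> d = 0 \<and> c \<bullet> d = 0 \<and>
     (1 / 2) *\<^sub>R (a + b + c + d) \<in> D4_roots"

lemma root_frame_rotate: "root_frame a b c d \<Longrightarrow> root_frame a c d b"
  by (simp add: root_frame_def inner_commute[of b] add.assoc add.commute[of b])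

text \<open>Subtracting \<open>b\<close> from the half sum flips the sign of \<open>b\<close> in it,
  and stays among the roots because the two have inner product 1.\<close>

lemma root_frame_uminus:
  assumes "root_frame a b c d"
  shows "root_frame a (- b) c d"
proof -
  let ?s = "(1 / 2) *\<^sub>R (a + b + c + d)"
  have "?s \<bullet> b = 1"
    using assms by (simp add: root_frame_def D4_roots_def inner_add_left inner_add_right inner_commute)
  then have "?s - b \<in> D4_roots"
    using assms by (intro D4_roots_diff) (auto simp: root_frame_def)
  moreover have "?s - b = (1 / 2) *\<^sub>R (a + - b + c + d)"
    by (simp add: vec_eq_iff field_simps)
  ultimately show ?thesis
    using assms by (simp add: root_frame_def D4_roots_uminus)
qed

lemma vector_4:
  "(vector [x, y, z, w] :: ('a::zero) ^ 4) $ 1 = x"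
  "(vector [x, y, z, w] :: ('a::zero) ^ 4) $ 2 = y"
  "(vector [x, y, z, w] :: ('a::zero) ^ 4) $ 3 = z"
  "(vector [x, y, z, w] :: ('a::zero) ^ 4) $ 4 = w"
  by (simp_all add: vector_def)

text \<open>Viewing \<open>x\<close> as a quaternion, the frame is \<open>x, x i, x j, x k\<close>; the half sum is integral
  because the coordinate sum of \<open>x\<close> has the parity of \<open>x \<bullet> x = 2\<close>.\<close>

lemma root_frame_exists:
  assumes "x \<in> D4_roots"
  shows "\<exists>b c d. root_frame x b c d"
proof -
  have "\<exists>k. x $ i = of_int k" for i
    using assms by (auto simp: D4_roots_def Ints_def)
  then obtain k where k: "\<And>i. x $ i = of_int (k i)"
    by metis
  let ?b = "vector [- x $ 2, x $ 1, x $ 4, - x $ 3] :: real ^ 4"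
  let ?c = "vector [- x $ 3, - x $ 4, x $ 1, x $ 2] :: real ^ 4"
  let ?d = "vector [- x $ 4, x $ 3, - x $ 2, x $ 1] :: real ^ 4"
  let ?h = "(1 / 2) *\<^sub>R (x + ?b + ?c + ?d)"
  have sq: "x \<bullet> x = 2"
    using assms by (rule D4_roots_inner_self)
  have "real_of_int (k 1 * k 1 + k 2 * k 2 + k 3 * k 3 + k 4 * k 4) = 2"
    using sq by (simp add: inner_4 k)
  then have "k 1 * k 1 + k 2 * k 2 + k 3 * k 3 + k 4 * k 4 = 2"
    by linarith
  then have "even (k 1 * k 1 + k 2 * k 2 + k 3 * k 3 + k 4 * k 4)"
    by simp
  then have "even (k 1 + k 2 + k 3 + k 4)"
    by simp
  then obtain m where "k 1 + k 2 + k 3 + k 4 = 2 * m"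
    by (rule evenE)
  then have "real_of_int (k 1 + k 2 + k 3 + k 4) = real_of_int (2 * m)"
    by (rule arg_cong)
  then have sum: "x $ 1 + x $ 2 + x $ 3 + x $ 4 = 2 * of_int m"
    by (simp add: k)
  have "?h $ 1 = of_int (k 1 - m)" "?h $ 2 = of_int (m - k 4)"
    "?h $ 3 = of_int (m - k 2)" "?h $ 4 = of_int (m - k 3)"
    using sum by (simp_all add: vector_4 k)
  then have "\<forall>i. ?h $ i \<in> \<int>"
    unfolding forall_4 by (simp only: Ints_of_int simp_thms)
  moreover have "?h \<bullet> ?h = 2"
    using sq by (simp add: inner_4 vector_4 field_simps)
  ultimately have "?h \<in> D4_roots"
    by (simp add: D4_roots_def)
  moreover have "{x, ?b, ?c, ?d} \<subseteq> D4_roots"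
    using assms by (auto simp: D4_roots_def inner_4 vector_4 forall_4)
  ultimately have "root_frame x ?b ?c ?d"
    by (simp add: root_frame_def inner_4 vector_4)
  then show ?thesis
    by blast
qed


text \<open>Four orthogonal nonzero vectors span the space, and the difference \<open>z\<close> of
  the two sides is orthogonal to each of them, hence to itself. The factor 2 is the squared norm of
  a root.\<close>

lemma root_frame_expansion:
  assumes "root_frame a b c d"
  shows "2 *\<^sub>R y = (y \<bullet> a) *\<^sub>R a + (y \<bullet> b) *\<^sub>R b + (y \<bullet> c) *\<^sub>R c + (y \<bullet> d) *\<^sub>R d"
proof -
  let ?S = "{a, b, c, d}"
  define z where "z = 2 *\<^sub>R y - ((y \<bullet> a) *\<^sub>R a + (y \<bullet> b) *\<^sub>R b + (y \<bullet> c) *\<^sub>R c + (y \<bullet> d) *\<^sub>R d)"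
  have sq: "a \<bullet> a = 2" "b \<bullet> b = 2" "c \<bullet> c = 2" "d \<bullet> d = 2"
    using assms by (auto simp: root_frame_def D4_roots_def)
  have ort: "a \<bullet> b = 0" "a \<bullet> c = 0" "a \<bullet> d = 0" "b \<bullet> c = 0" "b \<bullet> d = 0" "c \<bullet> d = 0"
    "b \<bullet> a = 0" "c \<bullet> a = 0" "d \<bullet> a = 0" "c \<bullet> b = 0" "d \<bullet> b = 0" "d \<bullet> c = 0"
    using assms by (auto simp: root_frame_def inner_commute)
  have ne: "a \<noteq> b" "a \<noteq> c" "a \<noteq> d" "b \<noteq> c" "b \<noteq> d" "c \<noteq> d"
    using sq ort by auto
  have "pairwise orthogonal ?S" "0 \<notin> ?S"
    using sq ort by (auto simp: pairwise_def orthogonal_def)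
  then have "independent ?S"
    by (rule pairwise_orthogonal_independent)
  then have "UNIV \<subseteq> span ?S"
    using ne by (intro card_ge_dim_independent) auto
  then have "z \<in> span ?S"
    by blast
  moreover have "orthogonal z u" if "u \<in> ?S" for u
    using that by (auto simp: z_def orthogonal_def inner_diff_left inner_add_left sq ort)
  ultimately have "orthogonal z z"
    by (rule orthogonal_to_span)
  then show ?thesis
    by (simp add: orthogonal_def z_def)
qed

lemma root_frame_parseval:
  assumes "root_frame a b c d"
  shows "2 * (y \<bullet> z) = (y \<bullet> a) * (z \<bullet> a) + (y \<bullet> b) * (z \<bullet> b) + (y \<bullet> c) * (z \<bullet> c) + (y \<bullet> d) * (z \<bullet> d)"
proof -
  have "2 * (y \<bullet> z) = (2 *\<^sub>R y) \<bullet> z"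
    by simp
  then show ?thesis
    unfolding root_frame_expansion[OF assms, of y] by (simp add: inner_add_left inner_add_right inner_commute)
qed

text \<open>In any frame through \<open>x\<close>, the squared products of \<open>y\<close> with the
  other three members lie in {0, 1, 4} and sum to 4. Since 1 + 1 + 1 < 4, one of them is 4, so
  \<open>y\<close> is a frame member up to sign.\<close>

lemma root_frame_extend:
  assumes x: "x \<in> D4_roots" and y: "y \<in> D4_roots" and ort: "x \<bullet> y = 0"
  shows "\<exists>c d. root_frame x y c d"
proof -
  obtain b c d where fr: "root_frame x b c d"
    using root_frame_exists[OF x] by blast
  then have R: "b \<in> D4_roots" "c \<in> D4_roots" "d \<in> D4_roots"
    by (auto simp: root_frame_def)
  have par: "(y \<bullet> b)\<^sup>2 + (y \<bullet> c)\<^sup>2 + (y \<bullet> d)\<^sup>2 = 4"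
    using root_frame_parseval[OF fr, of y y] D4_roots_inner_self[OF y] ort
    by (simp add: power2_eq_square inner_commute)
  have *: ?thesis if "root_frame x e f g" and "y \<bullet> e = 2 \<or> y \<bullet> e = - 2" for e f g
    using that(2)
  proof
    assume "y \<bullet> e = 2"
    then have "y = e"
      using that(1) y by (intro D4_roots_inner_eq_2) (auto simp: root_frame_def)
    then show ?thesis
      using that(1) by blast
  next
    assume "y \<bullet> e = - 2"
    then have "y = - e"
      using that(1) y by (intro D4_roots_inner_eq_minus_2) (auto simp: root_frame_def)
    then show ?thesis
      using root_frame_uminus[OF that(1)] by blast
  qed
  have sq: "(y \<bullet> e = 2 \<or> y \<bullet> e = - 2) \<or> (y \<bullet> e)\<^sup>2 = 0 \<or> (y \<bullet> e)\<^sup>2 = 1" if "e \<in> D4_roots" for e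
    using D4_roots_inner_cases[OF y that] by auto
  have "(y \<bullet> b = 2 \<or> y \<bullet> b = - 2) \<or> (y \<bullet> c = 2 \<or> y \<bullet> c = - 2) \<or> (y \<bullet> d = 2 \<or> y \<bullet> d = - 2)"
    using sq[OF R(1)] sq[OF R(2)] sq[OF R(3)] par by auto
  then show ?thesis
    using *[OF fr] *[OF root_frame_rotate[OF fr]] *[OF root_frame_rotate[OF root_frame_rotate[OF fr]]]
    by blast
qed

section \<open>Identification with the normalised roots\<close>

text \<open>An integer vector of squared norm 2 has entries 0, 1 or -1, so its squared norm counts
  the nonzero entries: there are exactly two.\<close>

lemma normalised_D4_roots_eq: "normalised_D4_roots = (\<lambda>x. (1 / sqrt 2) *\<^sub>R x) ` D4_roots"
proof (intro equalityI subsetI)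
  fix x
  assume "x \<in> normalised_D4_roots"
  then obtain s t i j where x: "x = (1 / sqrt 2) *\<^sub>R (s *\<^sub>R axis i 1 + t *\<^sub>R axis j 1)"
    and st: "s \<in> {1, - 1}" "t \<in> {1, - 1}" and ij: "i < j"
    unfolding normalised_D4_roots_def by blast
  let ?y = "s *\<^sub>R axis i 1 + t *\<^sub>R axis j 1 :: real ^ 4"
  have "?y $ k \<in> \<int>" for k
    using st by (auto simp: axis_def)
  moreover have "?y \<bullet> ?y = 2"
    using st ij by (auto simp: inner_add_left inner_add_right inner_axis_axis)
  ultimately show "x \<in> (\<lambda>x. (1 / sqrt 2) *\<^sub>R x) ` D4_roots"
    unfolding x by (auto simp: D4_roots_def)
next
  fix x
  assume "x \<in> (\<lambda>x. (1 / sqrt 2) *\<^sub>R x) ` D4_roots"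
  then obtain y where x: "x = (1 / sqrt 2) *\<^sub>R y" and y: "\<And>i. y $ i \<in> \<int>" "y \<bullet> y = 2"
    by (auto simp: D4_roots_def)
  have val: "y $ k = 0 \<or> y $ k = 1 \<or> y $ k = - 1" for k
  proof -
    obtain m where m: "y $ k = of_int m"
      using y(1) by (rule Ints_cases)
    have "(y $ k)\<^sup>2 \<le> (\<Sum>i\<in>UNIV. (y $ i)\<^sup>2)"
      by (rule member_le_sum) auto
    then have "real_of_int (m\<^sup>2) \<le> 2"
      using y(2) by (simp add: inner_vec_def power2_eq_square m)
    then have "m\<^sup>2 \<le> 2"
      by linarith
    then have "\<bar>m\<bar> < 2"
      by (intro power2_less_imp_less[of "\<bar>m\<bar>" 2]) auto
    then have "m \<in> {-1, 0, 1}"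
      by auto
    then show ?thesis
      using m by auto
  qed
  have "real (card {i. y $ i \<noteq> 0}) = (\<Sum>i\<in>UNIV. if y $ i \<noteq> 0 then 1 else 0)"
    by (simp add: sum.If_cases)
  also have "\<dots> = y \<bullet> y"
    unfolding inner_vec_def by (intro sum.cong refl) (use val in force)
  finally have "card {i. y $ i \<noteq> 0} = 2"
    using y(2) by simp
  then obtain i j where ij: "{i. y $ i \<noteq> 0} = {i, j}" "i \<noteq> j"
    by (auto simp: card_2_iff)
  have split: "y = (y $ a) *\<^sub>R axis a 1 + (y $ b) *\<^sub>R axis b 1"
    if "{i. y $ i \<noteq> 0} = {a, b}" "a \<noteq> b" for a b
    using that by (auto simp: vec_eq_iff axis_def)
  have *: "x \<in> normalised_D4_roots" if ab: "{i. y $ i \<noteq> 0} = {a, b}" "a < b" for a b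
  proof -
    have "y $ a \<in> {1, - 1}" "y $ b \<in> {1, - 1}"
      using ab(1) val[of a] val[of b] by auto
    moreover have "x = (1 / sqrt 2) *\<^sub>R ((y $ a) *\<^sub>R axis a 1 + (y $ b) *\<^sub>R axis b 1)"
      unfolding x using ab by (subst split[of a b]) auto
    ultimately show ?thesis
      unfolding normalised_D4_roots_def using ab(2) by blast
  qed
  from ij(2) show "x \<in> normalised_D4_roots"
    using *[of i j] *[of j i] ij(1) by (auto simp: neq_iff insert_commute)
qed

lemma finite_D4_roots: "finite D4_roots"
proof -
  have "finite normalised_D4_roots"
    using contact_configuration_normalised_D4_roots by (simp add: contact_configuration_def)
  then show ?thesis
    unfolding normalised_D4_roots_eq by (rule finite_imageD) (simp add: inj_on_def)
qed

section \<open>Neighbour sums and an equilibrium stress\<close>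

text \<open>The map \<open>y\<close> to \<open>x - y\<close> is an involution on the neighbours of
  \<open>x\<close>, so they pair off into sums equal to \<open>x\<close>.\<close>

lemma sum_D4_neighbours:
  assumes "x \<in> D4_roots"
  shows "2 *\<^sub>R (\<Sum>y | y \<in> D4_roots \<and> x \<bullet> y = 1. y) = real (card {y \<in> D4_roots. x \<bullet> y = 1}) *\<^sub>R x"
proof -
  let ?N = "{y \<in> D4_roots. x \<bullet> y = 1}"
  have "x - y \<in> ?N" if "y \<in> ?N" for y
    using that assms D4_roots_diff[of x y] by (simp add: inner_diff_right D4_roots_inner_self)
  then have "(\<Sum>y\<in>?N. y) = (\<Sum>y\<in>?N. x - y)"
    by (intro sum.reindex_bij_witness[of _ "\<lambda>y. x - y" "\<lambda>y. x - y"]) auto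
  then show ?thesis
    by (simp add: sum_subtractf scaleR_2 sum_constant_scaleR eq_diff_eq del: sum_constant)
qed

text \<open>In a frame with \<open>2 *\<^sub>R v = x + e + f + g\<close> the common neighbours are
  \<open>v - e\<close>, \<open>v - f\<close> and \<open>v - g\<close>, whose sum is 3v - (e + f + g)
  = x + v.\<close>

lemma sum_D4_common_neighbours:
  assumes x: "x \<in> D4_roots" and v: "v \<in> D4_roots" and xv: "x \<bullet> v = 1"
  shows "(\<Sum>y | y \<in> D4_roots \<and> x \<bullet> y = 1 \<and> v \<bullet> y = 1. y) = x + v"
proof -
  have sign: "\<exists>e f g. root_frame x e f g \<and> v \<bullet> e = 1 \<and> v \<bullet> f = 1 \<and> v \<bullet> g = 1"
  proof -
    obtain b c d where fr: "root_frame x b c d"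
      using root_frame_exists[OF x] by blast
    \<comment> \<open>Moves the first free member to the end with its sign corrected; three
      applications normalise all three members.\<close>
    have flip: "\<exists>e. root_frame x c d e \<and> v \<bullet> e = 1" if "root_frame x b c d" "v \<bullet> b = 1 \<or> v \<bullet> b = -1" for b c d
      using that(2)
    proof
      assume "v \<bullet> b = 1"
      then show ?thesis
        using root_frame_rotate[OF that(1)] by blast
    next
      assume "v \<bullet> b = -1"
      then have "v \<bullet> (- b) = 1"
        by simp
      then show ?thesis
        using root_frame_rotate[OF root_frame_uminus[OF that(1)]] by blast
    qed
    have R: "b \<in> D4_roots" "c \<in> D4_roots" "d \<in> D4_roots"
      using fr by (auto simp: root_frame_def)
    \<comment> \<open>Three squares from {0, 1, 4} with sum 3 must all be 1.\<close>
    have "(v \<bullet> b)\<^sup>2 + (v \<bullet> c)\<^sup>2 + (v \<bullet> d)\<^sup>2 = 3"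
      using root_frame_parseval[OF fr, of v v] D4_roots_inner_self[OF v] xv
      by (simp add: power2_eq_square inner_commute)
    moreover have sq: "((v \<bullet> e)\<^sup>2 = 1 \<and> (v \<bullet> e = 1 \<or> v \<bullet> e = -1)) \<or> (v \<bullet> e)\<^sup>2 = 0 \<or> (v \<bullet> e)\<^sup>2 = 4"
      if "e \<in> D4_roots" for e
      using D4_roots_inner_cases[OF v that] by auto
    ultimately have pm: "v \<bullet> b = 1 \<or> v \<bullet> b = -1" "v \<bullet> c = 1 \<or> v \<bullet> c = -1" "v \<bullet> d = 1 \<or> v \<bullet> d = -1"
      using sq[OF R(1)] sq[OF R(2)] sq[OF R(3)] by auto
    obtain e where e: "root_frame x c d e" "v \<bullet> e = 1"
      using flip[OF fr pm(1)] by blast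
    obtain f where f: "root_frame x d e f" "v \<bullet> f = 1"
      using flip[OF e(1) pm(2)] by blast
    obtain g where g: "root_frame x e f g" "v \<bullet> g = 1"
      using flip[OF f(1) pm(3)] by blast
    show ?thesis
      using e(2) f(2) g by blast
  qed
  then obtain e f g where fr: "root_frame x e f g" and ve: "v \<bullet> e = 1" "v \<bullet> f = 1" "v \<bullet> g = 1"
    by blast
  have R: "e \<in> D4_roots" "f \<in> D4_roots" "g \<in> D4_roots"
    using fr by (auto simp: root_frame_def)
  have ort: "x \<bullet> e = 0" "x \<bullet> f = 0" "x \<bullet> g = 0" "e \<bullet> f = 0" "e \<bullet> g = 0" "f \<bullet> g = 0"
    using fr by (auto simp: root_frame_def)
  have sum: "2 *\<^sub>R v = x + e + f + g"
    using root_frame_expansion[OF fr, of v] xv ve by (simp add: inner_commute)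
  have "{y \<in> D4_roots. x \<bullet> y = 1 \<and> v \<bullet> y = 1} = {v - e, v - f, v - g}"
  proof (intro equalityI subsetI)
    fix y
    assume "y \<in> {y \<in> D4_roots. x \<bullet> y = 1 \<and> v \<bullet> y = 1}"
    then have y: "y \<in> D4_roots" "x \<bullet> y = 1" "v \<bullet> y = 1"
      by auto
    have "(2 *\<^sub>R v) \<bullet> y = 2"
      using y(3) by simp
    then have "y \<bullet> e + y \<bullet> f + y \<bullet> g = 1"
      unfolding sum using y(2) by (simp add: inner_add_left inner_add_right inner_commute)
    moreover have "(y \<bullet> e)\<^sup>2 + (y \<bullet> f)\<^sup>2 + (y \<bullet> g)\<^sup>2 = 3"
      using root_frame_parseval[OF fr, of y y] D4_roots_inner_self[OF y(1)] y(2)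
      by (simp add: power2_eq_square inner_commute)
    moreover have sq: "y \<bullet> u = -1 \<or> y \<bullet> u = 1 \<and> (y \<bullet> u)\<^sup>2 = 1 \<or> (y \<bullet> u)\<^sup>2 = 0 \<or> (y \<bullet> u)\<^sup>2 = 4"
      if "u \<in> D4_roots" for u
      using D4_roots_inner_cases[OF y(1) that] by auto
    \<comment> \<open>The squares sum to 3, so all three products are 1 or -1; if none were -1 they
      would sum to 3 rather than 1.\<close>
    ultimately have "y \<bullet> e = -1 \<or> y \<bullet> f = -1 \<or> y \<bullet> g = -1"
      using sq[OF R(1)] sq[OF R(2)] sq[OF R(3)] by argo
    moreover have "y = v - u" if "u \<in> D4_roots" "v \<bullet> u = 1" "y \<bullet> u = -1" for u
    proof -
      have "v - u \<in> D4_roots"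
        using D4_roots_diff[OF v that(1,2)] .
      moreover have "y \<bullet> (v - u) = 2"
        using y(3) that by (simp add: inner_diff_right inner_commute)
      ultimately show ?thesis
        using D4_roots_inner_eq_2[OF y(1)] by blast
    qed
    ultimately show "y \<in> {v - e, v - f, v - g}"
      using R ve by blast
  next
    have "v - u \<in> {y \<in> D4_roots. x \<bullet> y = 1 \<and> v \<bullet> y = 1}"
      if "u \<in> D4_roots" "v \<bullet> u = 1" "x \<bullet> u = 0" for u
      using that D4_roots_diff[OF v that(1,2)] xv D4_roots_inner_self[OF v]
      by (simp add: inner_diff_right)
    moreover fix y
    assume "y \<in> {v - e, v - f, v - g}"
    ultimately show "y \<in> {y \<in> D4_roots. x \<bullet> y = 1 \<and> v \<bullet> y = 1}"
      using R ve ort by blast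
  qed
  moreover have "e \<noteq> f" "e \<noteq> g" "f \<noteq> g"
    using ort R(1,2)[THEN D4_roots_inner_self] by auto
  ultimately have "(\<Sum>y | y \<in> D4_roots \<and> x \<bullet> y = 1 \<and> v \<bullet> y = 1. y) = (v - e) + (v - f) + (v - g)"
    by simp
  also have "\<dots> = 2 *\<^sub>R v + v - (e + f + g)"
    by (simp add: scaleR_2)
  also have "\<dots> = x + v"
    unfolding sum by simp
  finally show ?thesis .
qed


text \<open>An equilibrium stress of the configuration without \<open>v\<close> that is positive on all edges:
  deleting \<open>v\<close> removes its pull on each neighbour, and this is compensated by doubling the stress
  on the edges between two neighbours of \<open>v\<close>.\<close>

definition stress :: "real ^ 4 \<Rightarrow> real ^ 4 \<Rightarrow> real ^ 4 \<Rightarrow> real" where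
  "stress v x y = (if x \<bullet> y = 1 then if x \<bullet> v = 1 \<and> y \<bullet> v = 1 then 2 else 1 else 0)"

lemma stress_commute: "stress v x y = stress v y x"
  by (auto simp: stress_def inner_commute)

text \<open>The full neighbour sum is already a multiple of \<open>x\<close>. If \<open>v\<close> is
  a neighbour, its deletion contributes -v and the doubled edges contribute \<open>x + v\<close>,
  leaving just another \<open>x\<close>.\<close>

lemma stress_equilibrium:
  assumes x: "x \<in> D4_roots" and v: "v \<in> D4_roots"
  shows "\<exists>c. (\<Sum>y\<in>D4_roots - {v}. stress v x y *\<^sub>R y) = c *\<^sub>R x"
proof -
  let ?N = "{y \<in> D4_roots. x \<bullet> y = 1}"
  let ?M = "{y \<in> D4_roots. x \<bullet> y = 1 \<and> v \<bullet> y = 1}"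
  have S: "\<Sum>?N = (real (card ?N) / 2) *\<^sub>R x"
  proof -
    have "\<Sum>?N = (1 / 2) *\<^sub>R (2 *\<^sub>R \<Sum>?N)"
      by simp
    then show ?thesis
      unfolding sum_D4_neighbours[OF x] by simp
  qed
  have *: "stress v x y *\<^sub>R y = (if x \<bullet> y = 1 then y else 0) +
      (if x \<bullet> v = 1 then if x \<bullet> y = 1 \<and> v \<bullet> y = 1 then y else 0 else 0)" for y
    by (auto simp: stress_def inner_commute scaleR_2)
  have eq: "?N - {v} = {y \<in> D4_roots - {v}. x \<bullet> y = 1}"
    "?M = {y \<in> D4_roots - {v}. x \<bullet> y = 1 \<and> v \<bullet> y = 1}"
    using D4_roots_inner_self[OF v] by auto
  have fin: "finite (D4_roots - {v})"
    using finite_D4_roots by simp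
  have "(\<Sum>y\<in>D4_roots - {v}. stress v x y *\<^sub>R y) =
      \<Sum>(?N - {v}) + (if x \<bullet> v = 1 then \<Sum>?M else 0)"
    unfolding * sum.distrib eq sum.inter_filter[OF fin] by simp
  also have "\<dots> = \<Sum>?N + (if x \<bullet> v = 1 then x else 0)"
    using v finite_D4_roots sum_D4_common_neighbours[OF x v] by (simp add: sum_diff1)
  also have "\<dots> = (real (card ?N) / 2 + (if x \<bullet> v = 1 then 1 else 0)) *\<^sub>R x"
    unfolding S by (simp add: scaleR_add_left)
  finally show ?thesis
    by blast
qed

section \<open>First-order strains and their vanishing\<close>

text \<open>The derivative of the inner product of \<open>x\<close> and \<open>y\<close> when they
  move with velocities \<open>D x\<close> and \<open>D y\<close>.\<close>

definition strain :: "(real ^ 4 \<Rightarrow> real ^ 4) \<Rightarrow> real ^ 4 \<Rightarrow> real ^ 4 \<Rightarrow> real" where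
  "strain D x y = D x \<bullet> y + x \<bullet> D y"

text \<open>With every velocity on the left, expanding the right factors by linearity leaves the
  arguments of \<open>D\<close> intact.\<close>

lemma strain_altdef: "strain D x y = D x \<bullet> y + D y \<bullet> x"
  by (simp add: strain_def inner_commute)

lemma strain_commute: "strain D x y = strain D y x"
  by (simp add: strain_def inner_commute)

context
  fixes v :: "real ^ 4" and D :: "real ^ 4 \<Rightarrow> real ^ 4"
  assumes v: "v \<in> D4_roots"
    and tangent: "\<And>x. x \<in> D4_roots - {v} \<Longrightarrow> D x \<bullet> x = 0"
    and contact: "\<And>x y. x \<in> D4_roots - {v} \<Longrightarrow> y \<in> D4_roots - {v} \<Longrightarrow> x \<bullet> y = 1 \<Longrightarrow> strain D x y \<le> 0"
begin

text \<open>Equilibrium makes the weighted sum of neighbours parallel to \<open>x\<close>, and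
  tangency annihilates it against \<open>D x\<close>. So the total of stress times strain is 0; its
  terms are all nonpositive, hence zero, and the stress is positive on edges.\<close>

lemma strain_edge:
  assumes x: "x \<in> D4_roots - {v}" and y: "y \<in> D4_roots - {v}" and xy: "x \<bullet> y = 1"
  shows "strain D x y = 0"
proof -
  let ?W = "D4_roots - {v}"
  have fin: "finite ?W"
    using finite_D4_roots by simp
  have half: "(\<Sum>x\<in>?W. \<Sum>y\<in>?W. stress v x y * (D x \<bullet> y)) = 0"
  proof (rule sum.neutral, rule ballI)
    fix x
    assume x: "x \<in> ?W"
    then obtain c where c: "(\<Sum>y\<in>?W. stress v x y *\<^sub>R y) = c *\<^sub>R x"
      using stress_equilibrium[of x v] v by auto
    have "(\<Sum>y\<in>?W. stress v x y * (D x \<bullet> y)) = D x \<bullet> (\<Sum>y\<in>?W. stress v x y *\<^sub>R y)"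
      by (simp add: inner_sum_right)
    then show "(\<Sum>y\<in>?W. stress v x y * (D x \<bullet> y)) = 0"
      unfolding c using tangent[OF x] by simp
  qed
  have "(\<Sum>x\<in>?W. \<Sum>y\<in>?W. stress v x y * (x \<bullet> D y)) = (\<Sum>x\<in>?W. \<Sum>y\<in>?W. stress v x y * (D x \<bullet> y))"
    by (subst sum.swap) (simp add: stress_commute[of v] inner_commute)
  then have "(\<Sum>x\<in>?W. \<Sum>y\<in>?W. - (stress v x y * strain D x y)) = 0"
    using half by (simp add: strain_def distrib_left sum.distrib sum_negf sum_subtractf)
  moreover have nonneg: "- (stress v x y * strain D x y) \<ge> 0" if "x \<in> ?W" "y \<in> ?W" for x y
    using contact[OF that] by (auto simp: stress_def)
  ultimately have "(\<Sum>y\<in>?W. - (stress v x y * strain D x y)) = 0"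
    using x by (intro sum_nonneg_0[OF fin, of "\<lambda>x. \<Sum>y\<in>?W. - (stress v x y * strain D x y)"] sum_nonneg)
  then have "- (stress v x y * strain D x y) = 0"
    using nonneg x y by (intro sum_nonneg_0[OF fin, of "\<lambda>y. - (stress v x y * strain D x y)"])
  then show ?thesis
    using xy by (auto simp: stress_def split: if_splits)
qed

text \<open>The pairs \<open>x, y\<close> with \<open>x \<bullet> y = 0\<close> are the antipodal pairs of the octahedra with centre
  \<open>(x + y) / 2\<close>. The edges of an octahedron make the strains of any two of its three antipodal
  pairs opposite, so all three vanish.\<close>

lemma strain_octahedron:
  assumes x: "x \<in> D4_roots - {v}" and y: "y \<in> D4_roots - {v}" and xy: "x \<bullet> y = 0"
    and not_v: "x \<bullet> v \<noteq> 1 \<or> y \<bullet> v \<noteq> 1"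
  shows "strain D x y = 0"
proof -
  have R: "x \<in> D4_roots" "y \<in> D4_roots"
    using x y by auto
  obtain e f where fr: "root_frame x y e f"
    using root_frame_extend[OF R xy] by blast
  have sq: "x \<bullet> x = 2" "y \<bullet> y = 2" "e \<bullet> e = 2" "f \<bullet> f = 2"
    and ort: "x \<bullet> e = 0" "x \<bullet> f = 0" "y \<bullet> e = 0" "y \<bullet> f = 0" "e \<bullet> f = 0"
    using fr by (auto simp: root_frame_def D4_roots_def)
  \<comment> \<open>The remaining vertices of the octahedron are \<open>p\<close>, \<open>q\<close>
    and their antipodes \<open>x + y - p\<close>, \<open>x + y - q\<close>.\<close>
  define p where "p = (1 / 2) *\<^sub>R (x + y + e + f)"
  define q where "q = (1 / 2) *\<^sub>R (x + y + e - f)"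
  have pq: "p \<bullet> x = 1" "p \<bullet> y = 1" "q \<bullet> x = 1" "q \<bullet> y = 1" "p \<bullet> q = 1" "p \<bullet> f = 1" "p \<bullet> p = 2" "q \<bullet> q = 2"
    "x \<bullet> p = 1" "y \<bullet> p = 1" "x \<bullet> q = 1" "y \<bullet> q = 1" "q \<bullet> p = 1"
    unfolding p_def q_def using sq ort xy
    by (simp_all add: inner_add_left inner_add_right inner_diff_left inner_diff_right inner_commute)
  have p: "p \<in> D4_roots"
    using fr by (simp add: root_frame_def p_def)
  have "q = p - f"
    by (simp add: p_def q_def vec_eq_iff field_simps)
  then have q: "q \<in> D4_roots"
    using D4_roots_diff[OF p _ pq(6)] fr by (simp add: root_frame_def)
  have opp: "x + y - u \<in> D4_roots" if u: "u \<in> D4_roots" "u \<bullet> x = 1" "u \<bullet> y = 1" for u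
  proof -
    have "y - (u - x) \<in> D4_roots"
      using u xy D4_roots_uminus[OF D4_roots_diff[OF u(1) R(1) u(2)]] D4_roots_diff[OF R(2), of "u - x"]
        D4_roots_diff[OF u(1) R(1) u(2)]
      by (simp add: inner_diff_right inner_commute)
    then show ?thesis
      by (simp add: algebra_simps)
  qed
  \<comment> \<open>By \<open>not_v\<close>, the deleted root cannot touch both \<open>x\<close> and
    \<open>y\<close>, so no vertex of the octahedron is missing.\<close>
  have ne: "u \<in> D4_roots - {v}" if "u \<in> D4_roots" "u \<bullet> x = 1" "u \<bullet> y = 1" for u
    using that not_v by (auto simp: inner_commute)
  let ?p' = "x + y - p" and ?q' = "x + y - q"
  have inn: "?p' \<bullet> x = 1" "?p' \<bullet> y = 1" "?q' \<bullet> x = 1" "?q' \<bullet> y = 1" "?p' \<bullet> q = 1" "p \<bullet> ?q' = 1" "?p' \<bullet> ?q' = 1"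
    using pq sq xy
    by (simp_all add: inner_diff_left inner_diff_right inner_add_left inner_add_right inner_commute)
  have W: "p \<in> D4_roots - {v}" "q \<in> D4_roots - {v}" "?p' \<in> D4_roots - {v}" "?q' \<in> D4_roots - {v}"
    using ne[OF p pq(1,2)] ne[OF q pq(3,4)] ne[OF opp[OF p pq(1,2)] inn(1,2)]
      ne[OF opp[OF q pq(3,4)] inn(3,4)] .
  note edges = strain_edge[OF W(1) x pq(1)] strain_edge[OF W(1) y pq(2)]
    strain_edge[OF W(2) x pq(3)] strain_edge[OF W(2) y pq(4)]
    strain_edge[OF W(3) x inn(1)] strain_edge[OF W(3) y inn(2)]
    strain_edge[OF W(4) x inn(3)] strain_edge[OF W(4) y inn(4)]
    strain_edge[OF W(1,2) pq(5)] strain_edge[OF W(3,2) inn(5)]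
    strain_edge[OF W(1,4) inn(6)] strain_edge[OF W(3,4) inn(7)]
  note tangents = tangent[OF x] tangent[OF y] tangent[OF W(1)] tangent[OF W(2)] tangent[OF W(3)] tangent[OF W(4)]
  \<comment> \<open>Each antipodal pair sums to \<open>x + y\<close>. By tangency, the strains of
    the four edges joining two antipodal pairs therefore add up to the sum of the strains of these
    two pairs.\<close>
  show ?thesis
    using edges tangents unfolding strain_altdef inner_diff_right inner_add_right
    by linarith
qed

text \<open>The sum \<open>?E\<close> is orthogonal to \<open>y\<close> by tangency. For a root
  \<open>u\<close> orthogonal to \<open>y\<close>, adding the strains of \<open>u\<close> with
  \<open>y\<close> and with \<open>- y\<close> cancels \<open>D u\<close> and leaves
  \<open>?E \<bullet> u\<close>; replacing \<open>u\<close> by \<open>- u\<close> if necessary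
  ensures that \<open>u\<close> does not touch \<open>v\<close>. A frame through \<open>y\<close>
  then gives \<open>?E = 0\<close>.\<close>

lemma motion_uminus:
  assumes y: "y \<in> D4_roots - {v}" and y': "- y \<in> D4_roots - {v}"
  shows "D (- y) = - D y"
proof -
  let ?E = "D (- y) + D y"
  obtain e f g where fr: "root_frame y e f g"
    using root_frame_exists y by blast
  have "?E \<bullet> y = 0"
    using tangent[OF y] tangent[OF y'] by (simp add: inner_add_left)
  moreover have "?E \<bullet> u = 0" if u: "u \<in> D4_roots" and yu: "y \<bullet> u = 0" for u
  proof -
    have *: "?E \<bullet> u = 0" if u: "u \<in> D4_roots" and yu: "y \<bullet> u = 0" and uv: "u \<bullet> v \<le> 0" for u
    proof -
      have uW: "u \<in> D4_roots - {v}"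
        using u uv D4_roots_inner_self[OF v] by auto
      have "strain D y u = 0" "strain D (- y) u = 0"
        using strain_octahedron[OF y uW] strain_octahedron[OF y' uW] yu uv by auto
      then show ?thesis
        by (simp add: strain_def inner_add_left)
    qed
    show ?thesis
      using *[of u] *[of "- u"] u yu D4_roots_uminus[OF u] by (cases "u \<bullet> v \<le> 0") auto
  qed
  ultimately have "2 *\<^sub>R ?E = 0"
    using root_frame_expansion[OF fr, of ?E] fr by (simp add: root_frame_def)
  then show ?thesis
    by (simp add: eq_neg_iff_add_eq_0)
qed

text \<open>Negating one member turns product -1 into an edge, and turns an orthogonal pair touching
  \<open>v\<close> twice into one that the octahedra cover. The negated root must differ from
  \<open>v\<close>.\<close>

lemma strain_eq_0:
  assumes x: "x \<in> D4_roots - {v}" and y: "y \<in> D4_roots - {v}"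
  shows "strain D x y = 0"
proof -
  have flip: "strain D x y = 0"
    if "x \<in> D4_roots - {v}" "- x \<in> D4_roots - {v}" "strain D (- x) y = 0" for x y
    using that(3) motion_uminus[OF that(1,2)] by (simp add: strain_def)
  have neg: "- u \<in> D4_roots - {v}" if "u \<in> D4_roots" "u \<noteq> - v" for u
    using that D4_roots_uminus by auto
  have vv: "v \<bullet> v = 2"
    using v by (rule D4_roots_inner_self)
  have minus_one: "strain D x y = 0"
    if x: "x \<in> D4_roots - {v}" and y: "y \<in> D4_roots - {v}" and xy: "x \<bullet> y = - 1" and xv: "x \<noteq> - v" for x y
  proof -
    have x': "- x \<in> D4_roots - {v}"
      using x xv by (intro neg) auto
    then show ?thesis
      using flip[OF x x' strain_edge[OF x' y]] xy by simp
  qed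
  consider "x \<bullet> y = - 2" | "x \<bullet> y = - 1" | "x \<bullet> y = 0" | "x \<bullet> y = 1" | "x \<bullet> y = 2"
    using D4_roots_inner_cases x y by blast
  then show ?thesis
  proof cases
    case 1
    then have "x = - y"
      using x y by (intro D4_roots_inner_eq_minus_2) auto
    then show ?thesis
      using motion_uminus[OF y] x tangent[OF y] by (simp add: strain_def inner_commute)
  next
    case 2
    \<comment> \<open>If both were \<open>- v\<close>, their product would be 2; so at least one
      member can be negated.\<close>
    then have "x \<noteq> - v \<or> y \<noteq> - v"
      using vv by auto
    then show ?thesis
      using minus_one[OF x y 2] minus_one[OF y x] 2 by (auto simp: strain_commute[of D x] inner_commute)
  next
    case 3
    show ?thesis
    proof (cases "x \<bullet> v = 1 \<and> y \<bullet> v = 1")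
      case True
      then have x': "- x \<in> D4_roots - {v}"
        using x vv by (intro neg) auto
      then have "strain D (- x) y = 0"
        using 3 y True by (intro strain_octahedron) auto
      then show ?thesis
        using flip x x' by blast
    next
      case False
      then show ?thesis
        using strain_octahedron[OF x y 3] by blast
    qed
  next
    case 4
    then show ?thesis
      using strain_edge x y by blast
  next
    case 5
    then have "x = y"
      using x y by (intro D4_roots_inner_eq_2) auto
    then show ?thesis
      using tangent[OF y] by (simp add: strain_def inner_commute)
  qed
qed

section \<open>Construction of the skew matrix\<close>

text \<open>\<open>L\<close> is the linear map agreeing with \<open>D\<close> on a frame. Vanishing
  strains make it adjoint to \<open>- D\<close> against every remaining root; testing on the frame
  yields both \<open>D = L\<close> on the roots and skewness.\<close>

lemma motion_is_rotation: "\<exists>A :: real ^ 4 ^ 4. transpose A = - A \<and> (\<forall>x \<in> D4_roots - {v}. D x = A *v x)"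
proof -
  \<comment> \<open>A frame avoiding \<open>v\<close> is needed. It is built through a neighbour
    \<open>a\<close> of \<open>v\<close>: its other members are orthogonal to \<open>a\<close>,
    whereas \<open>v\<close> is not.\<close>
  obtain b c d where "root_frame v b c d"
    using root_frame_exists[OF v] by blast
  then have "(1 / 2) *\<^sub>R (v + b + c + d) \<in> D4_roots" "v \<bullet> ((1 / 2) *\<^sub>R (v + b + c + d)) = 1"
    using D4_roots_inner_self[OF v] by (simp_all add: root_frame_def inner_add_right)
  then obtain a where a: "a \<in> D4_roots" "v \<bullet> a = 1"
    by blast
  obtain b c d where fr: "root_frame a b c d"
    using root_frame_exists[OF a(1)] by blast
  have W: "a \<in> D4_roots - {v}" "b \<in> D4_roots - {v}" "c \<in> D4_roots - {v}" "d \<in> D4_roots - {v}"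
    using fr a D4_roots_inner_self[OF v] by (auto simp: root_frame_def inner_commute)
  define L where "L y = (1 / 2) *\<^sub>R ((y \<bullet> a) *\<^sub>R D a + (y \<bullet> b) *\<^sub>R D b + (y \<bullet> c) *\<^sub>R D c + (y \<bullet> d) *\<^sub>R D d)" for y
  have "linear L"
    by (rule linearI) (simp_all add: L_def inner_add_left algebra_simps)
  then have mat: "matrix L *v y = L y" for y
    by (simp add: matrix_works linear_matrix_vector_mul_eq)
  have L: "L z \<bullet> u = - (z \<bullet> D u)" if u: "u \<in> D4_roots - {v}" for z u
  proof -
    have anti: "D t \<bullet> u = - (t \<bullet> D u)" if "t \<in> D4_roots - {v}" for t
      using strain_eq_0[OF that u] by (simp add: strain_def)
    have "2 * (L z \<bullet> u) = - ((2 *\<^sub>R z) \<bullet> D u)"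
      unfolding root_frame_expansion[OF fr, of z]
      by (simp add: L_def inner_add_left anti[OF W(1)] anti[OF W(2)] anti[OF W(3)] anti[OF W(4)])
    then show ?thesis
      by simp
  qed
  have DL: "D x = L x" if x: "x \<in> D4_roots - {v}" for x
  proof -
    have "D x \<bullet> u = L x \<bullet> u" if u: "u \<in> D4_roots - {v}" for u
      using L[OF u] strain_eq_0[OF x u] by (simp add: strain_def)
    then have "2 *\<^sub>R D x = 2 *\<^sub>R L x"
      using W by (simp only: root_frame_expansion[OF fr])
    then show ?thesis
      by simp
  qed
  have skew: "L y \<bullet> z = - (y \<bullet> L z)" for y z
  proof -
    have "2 * (y \<bullet> L z) = (2 *\<^sub>R y) \<bullet> L z"
      by simp
    also have "\<dots> = - ((y \<bullet> a) * (z \<bullet> D a) + (y \<bullet> b) * (z \<bullet> D b) + (y \<bullet> c) * (z \<bullet> D c) + (y \<bullet> d) * (z \<bullet> D d))"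
      unfolding root_frame_expansion[OF fr, of y]
      using L[OF W(1), of z] L[OF W(2), of z] L[OF W(3), of z] L[OF W(4), of z]
      by (simp add: inner_add_left inner_add_right inner_commute[of _ "L z"])
    also have "\<dots> = - 2 * (L y \<bullet> z)"
      by (simp add: L_def inner_add_left inner_commute[of z])
    finally show ?thesis
      by simp
  qed
  have "transpose (matrix L) $ i $ j = (- matrix L) $ i $ j" for i j
    using skew[of "axis i 1" "axis j 1"] by (simp add: inner_axis inner_axis' transpose_def matrix_def)
  then have "transpose (matrix L) = - matrix L"
    by (simp only: vec_eq_iff simp_thms)
  then show ?thesis
    using mat DL by (intro exI[of _ "matrix L"]) simp
qed

end

section \<open>Transfer to the labelled unit vectors\<close>

theorem proposition7p48:
  fixes v :: "real ^ 4" and w d :: "nat \<Rightarrow> real ^ 4"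
  assumes "v \<in> normalised_D4_roots"
    and "bij_betw w {1..23} (normalised_D4_roots - {v})"
    and "first_order_motion {1..23} w d"
  shows "infinitesimal_rotation {1..23} w d"
proof -
  let ?I = "{1..23} :: nat set"
  obtain v' where v': "v' \<in> D4_roots" "v = (1 / sqrt 2) *\<^sub>R v'"
    using assms(1) unfolding normalised_D4_roots_eq by blast
  \<comment> \<open>\<open>k x\<close> is the label of the unit vector in direction
    \<open>x\<close>; \<open>D\<close> carries the velocities over to the roots without rescaling
    them.\<close>
  define k where "k x = inv_into ?I w ((1 / sqrt 2) *\<^sub>R x)" for x
  define D where "D x = d (k x)" for x
  have k: "k x \<in> ?I" "w (k x) = (1 / sqrt 2) *\<^sub>R x" if "x \<in> D4_roots - {v'}" for x
  proof -
    have "(1 / sqrt 2) *\<^sub>R x \<in> normalised_D4_roots - {v}"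
      using that by (auto simp: normalised_D4_roots_eq v'(2))
    then have "(1 / sqrt 2) *\<^sub>R x \<in> w ` ?I"
      using assms(2) by (simp add: bij_betw_def)
    then show "k x \<in> ?I" "w (k x) = (1 / sqrt 2) *\<^sub>R x"
      unfolding k_def by (rule inv_into_into, rule f_inv_into_f)
  qed
  have scale: "x = sqrt 2 *\<^sub>R w (k x)" if "x \<in> D4_roots - {v'}" for x
    by (simp add: k(2)[OF that])
  have tangent: "D x \<bullet> x = 0" if x: "x \<in> D4_roots - {v'}" for x
  proof -
    have "d (k x) \<bullet> w (k x) = 0"
      using assms(3) k(1)[OF x] by (simp add: first_order_motion_def)
    then show ?thesis
      by (simp add: D_def k(2)[OF x])
  qed
  have contact: "strain D x y \<le> 0"
    if x: "x \<in> D4_roots - {v'}" and y: "y \<in> D4_roots - {v'}" and xy: "x \<bullet> y = 1" for x y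
  proof -
    have "x \<noteq> y"
      using xy x by (auto simp: D4_roots_inner_self)
    then have "k x \<noteq> k y"
      using scale[OF x] scale[OF y] by metis
    moreover have "w (k x) \<bullet> w (k y) = 1 / 2"
      using xy by (simp add: k(2)[OF x] k(2)[OF y])
    ultimately have "d (k x) \<bullet> w (k y) + w (k x) \<bullet> d (k y) \<le> 0"
      using assms(3) k(1)[OF x] k(1)[OF y] unfolding first_order_motion_def by blast
    then have "strain D x y / sqrt 2 \<le> 0"
      by (simp add: strain_def D_def k(2)[OF x] k(2)[OF y] add_divide_distrib)
    then show ?thesis
      by (simp add: divide_le_0_iff)
  qed
  obtain A :: "real ^ 4 ^ 4" where A: "transpose A = - A" "\<And>x. x \<in> D4_roots - {v'} \<Longrightarrow> D x = A *v x"
    using motion_is_rotation[OF v'(1) tangent contact] by blast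
  \<comment> \<open>Positions were scaled by \<open>sqrt 2\<close> but velocities were not, so the
    matrix absorbs this factor.\<close>
  have "d i = (sqrt 2 *\<^sub>R A) *v w i" if i: "i \<in> ?I" for i
  proof -
    have "w i \<in> normalised_D4_roots - {v}"
      using assms(2) i by (auto simp: bij_betw_def)
    then obtain x where x: "x \<in> D4_roots - {v'}" "w i = (1 / sqrt 2) *\<^sub>R x"
      unfolding normalised_D4_roots_eq v'(2) by blast
    have "k x = i"
      unfolding k_def x(2)[symmetric] using assms(2) i by (simp add: bij_betw_def)
    then have "d i = A *v x"
      using A(2)[OF x(1)] by (simp add: D_def)
    then show ?thesis
      by (simp add: x(2) scaleR_matrix_vector_assoc[symmetric] matrix_vector_mult_scaleR)
  qed
  moreover have "transpose (sqrt 2 *\<^sub>R A) = sqrt 2 *\<^sub>R transpose A"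
    by (simp add: vec_eq_iff transpose_def)
  then have "transpose (sqrt 2 *\<^sub>R A) = - (sqrt 2 *\<^sub>R A)"
    by (simp add: A(1))
  ultimately show ?thesis
    unfolding infinitesimal_rotation_def by blast
qed

end
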